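(* Let $\mathcal H$ be a real Hilbert space with inner product $\langle\cdot,\cdot\rangle$. Let $S$ be an (unbounded) linear operator on $\mathcal H$ with domain $\mathcal D$, let $A$ be another linear operator on $\mathcal H$ whose domain contains $\mathcal D$, and put $S_A = S + A$ and $S_{-A} = S - A$, both with domain $\mathcal D$. Assume: (1) $S$ is symmetric and positive, and $A$ is antisymmetric; (2) $S$ is a bijection from $\mathcal D$ onto $\mathcal H$ with a bounded inverse; (3) $S_A$ and $S_{-A}$ are bijections from $\mathcal D$ onto $\mathcal H$. Then, for every $f \in \mathcal H$, $$\langle S_A^{-1} f, f \rangle \le \langle S^{-1} f, f \rangle .$$
   Context: Symmetric means $\langle Sf,g\rangle=\langle f,Sg\rangle$ for all $f,g$ in the domain of $S$; positive means $\langle Sf,f\rangle\ge 0$ for all $f$ in the domain of $S$; antisymmetric means $\langle Af,g\rangle=-\langle f,Ag\rangle$ for all $f,g$ in the domain of $A$. *)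

theory Defs
  imports "HOL-Analysis.Analysis"
begin

text \<open>An unbounded operator is given by its domain, a linear subspace \<open>D\<close>, and a function
  \<open>T\<close> whose values outside \<open>D\<close> are irrelevant. Domains are not assumed dense.\<close>

definition linear_operator :: "'a::real_vector set \<Rightarrow> ('a \<Rightarrow> 'a) \<Rightarrow> bool" where
  "linear_operator D T \<longleftrightarrow> subspace D
     \<and> (\<forall>x\<in>D. \<forall>y\<in>D. T (x + y) = T x + T y)
     \<and> (\<forall>c. \<forall>x\<in>D. T (c *\<^sub>R x) = c *\<^sub>R T x)"

definition symmetric_operator :: "'a::real_inner set \<Rightarrow> ('a \<Rightarrow> 'a) \<Rightarrow> bool" where
  "symmetric_operator D T \<longleftrightarrow> (\<forall>f\<in>D. \<forall>g\<in>D. inner (T f) g = inner f (T g))"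

definition antisymmetric_operator :: "'a::real_inner set \<Rightarrow> ('a \<Rightarrow> 'a) \<Rightarrow> bool" where
  "antisymmetric_operator D T \<longleftrightarrow> (\<forall>f\<in>D. \<forall>g\<in>D. inner (T f) g = - inner f (T g))"

definition positive_operator :: "'a::real_inner set \<Rightarrow> ('a \<Rightarrow> 'a) \<Rightarrow> bool" where
  "positive_operator D T \<longleftrightarrow> (\<forall>f\<in>D. inner (T f) f \<ge> 0)"

end

theory Submission
  imports Defs
begin

text \<open>Let \<open>u\<close> and \<open>v\<close> be the solutions of \<open>S u + A u = f\<close> and \<open>S v = f\<close>. Antisymmetry kills
  \<open>\<langle>A u, u\<rangle>\<close>, so \<open>\<langle>f, u\<rangle> = \<langle>S u, u\<rangle>\<close>, and positivity of \<open>S\<close> at \<open>v - u\<close> reads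
  \<open>0 \<le> \<langle>f, v\<rangle> - 2 \<langle>f, u\<rangle> + \<langle>S u, u\<rangle> = \<langle>f, v\<rangle> - \<langle>f, u\<rangle>\<close>.\<close>

lemma linear_operator_diff:
  assumes "linear_operator D T" "x \<in> D" "y \<in> D"
  shows "x - y \<in> D" "T (x - y) = T x - T y"
proof -
  show xy: "x - y \<in> D"
    using assms by (auto simp: linear_operator_def intro: subspace_diff)
  \<comment> \<open>Additivity at \<open>(x - y) + y\<close> yields the difference rule without
    passing through the scalar -1.\<close>
  have "T ((x - y) + y) = T (x - y) + T y"
    using assms xy unfolding linear_operator_def by blast
  then show "T (x - y) = T x - T y" by simp
qed

text \<open>The real inner product commutes, so this number equals its own negative.\<close>

lemma antisymmetric_operator_inner_self:
  assumes "antisymmetric_operator D T" "x \<in> D"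
  shows "inner (T x) x = 0"
proof -
  have "inner (T x) x = - inner x (T x)"
    using assms unfolding antisymmetric_operator_def by blast
  then show ?thesis by (simp add: inner_commute)
qed

theorem theorem2p1:
  fixes D DA :: "'a::{real_inner, complete_space} set"
    and S A :: "'a \<Rightarrow> 'a"
    and f :: 'a
  assumes "linear_operator D S"
    and "linear_operator DA A"
    and "D \<subseteq> DA"
    and "symmetric_operator D S"
    and "positive_operator D S"
    and "antisymmetric_operator DA A"
    and "bij_betw S D UNIV"
    and "bounded_linear (inv_into D S)"
    and "bij_betw (\<lambda>x. S x + A x) D UNIV"
    and "bij_betw (\<lambda>x. S x - A x) D UNIV"
  shows "inner (inv_into D (\<lambda>x. S x + A x) f) f \<le> inner (inv_into D S f) f"
proof -
  define u where "u = inv_into D (\<lambda>x. S x + A x) f"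
  define v where "v = inv_into D S f"
  have "f \<in> (\<lambda>x. S x + A x) ` D" "f \<in> S ` D"
    using assms(7,9) by (simp_all add: bij_betw_def)
  then have u: "u \<in> D" "S u + A u = f" and v: "v \<in> D" "S v = f"
    unfolding u_def v_def by (blast intro: inv_into_into f_inv_into_f[where f = "\<lambda>x. S x + A x"] f_inv_into_f)+
  have "inner (A u) u = 0"
    using antisymmetric_operator_inner_self assms(3,6) u(1) by blast
  then have fu: "inner (S u) u = inner f u"
    using u(2) by (metis add.right_neutral inner_add_left)
  \<comment> \<open>Symmetry of \<open>S\<close> handles one cross term of the expansion below; the
    other, \<open>inner (S v) u\<close>, is \<open>inner f u\<close> at once because
    \<open>S v = f\<close>.\<close>
  have "inner (S u) v = inner u (S v)"
    using assms(4) u(1) v(1) unfolding symmetric_operator_def by blast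
  then have uv: "inner (S u) v = inner f u"
    by (simp add: v(2) inner_commute)
  have "0 \<le> inner (S (v - u)) (v - u)"
    using assms(5) linear_operator_diff(1)[OF assms(1) v(1) u(1)]
    unfolding positive_operator_def by blast
  also have "\<dots> = inner f v - inner f u"
    unfolding linear_operator_diff(2)[OF assms(1) v(1) u(1)]
    by (simp add: inner_diff_left inner_diff_right fu uv v(2))
  finally show ?thesis
    unfolding u_def v_def by (simp add: inner_commute)
qed

end
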